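(* There is a comeager subset of $\mathcal C(\{0,1\}^{\mathbb N})$ such that each $f$ in this set has the following property: for every $\sigma\in\{0,1\}^{\mathbb N}$, the restriction of $f$ to the $\omega$-limit set $\omega(\sigma,f)$ is topologically conjugate to the universal odometer.
   Context: $\{0,1\}^{\mathbb N}$ ($\mathbb N$ the positive integers) has the product topology and the metric $d(\sigma,\tau)=1/n$, where $n$ is the least positive integer with $\sigma(n)\neq\tau(n)$, and $d(\sigma,\sigma)=0$. $\mathcal C(\{0,1\}^{\mathbb N})$ is the space of all continuous self-maps of $\{0,1\}^{\mathbb N}$ with the metric $\tilde d(f,g)=\max_\sigma d(f(\sigma),g(\sigma))$. The $\omega$-limit set $\omega(x,f)$ is the set of all limits of convergent subsequences of $(f^n(x))_{n\in\mathbb N}$. Self-maps $f$ of $X$ and $g$ of $Y$ are topologically conjugate if there is a homeomorphism $\theta$ from $X$ onto $Y$ with $f=\theta^{-1}g\theta$. For $\alpha\in(\mathbb N\setminus\{1\})^{\mathbb N}$ let $\Delta_\alpha=\prod_{i=1}^\infty\mathbb Z_{\alpha(i)}$, where $\mathbb Z_k=\{0,\dots,k-1\}$ is discrete, with the product topology. Addition on $\Delta_\alpha$ is with carry: $(x_i)+(y_i)=(z_i)$, where $z_i=x_i+y_i+\epsilon_{i-1}\bmod\alpha(i)$, $\epsilon_0=0$, and for $i\ge2$, $\epsilon_{i-1}=0$ if $x_{i-1}+y_{i-1}+\epsilon_{i-2}<\alpha(i-1)$ and $\epsilon_{i-1}=1$ otherwise. The odometer is the map $f_\alpha:\Delta_\alpha\to\Delta_\alpha$,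 $f_\alpha(x)=x+(1,0,0,\dots)$. For a prime $p$, $M_\alpha(p)=\sum_{i=1}^\infty n(i)\in\{0,1,\dots,\infty\}$, where $n(i)$ is the largest integer such that $p^{n(i)}$ divides $\alpha(i)$. When $M_\alpha(p)=\infty$ for every prime $p$, $f_\alpha$ is called a universal odometer; any two universal odometers are topologically conjugate (Buescu–Stewart), so one speaks of the universal odometer. *)

theory Defs
  imports "HOL-Analysis.Analysis" "HOL-Computational_Algebra.Primes"
begin
text \<open>
  Sequences are indexed from 0, so the index \<open>n :: nat\<close> stands for the positive integer \<open>Suc n\<close>;
  \<open>False\<close> and \<open>True\<close> stand for 0 and 1. As \<open>bool\<close> is discrete, the topology of the type
  \<open>nat \<Rightarrow> bool\<close> is the product topology.
\<close>

type_synonym cantor = "nat \<Rightarrow> bool"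

definition cantor_dist :: "cantor \<Rightarrow> cantor \<Rightarrow> real" where
  "cantor_dist \<sigma> \<tau> = (if \<sigma> = \<tau> then 0 else 1 / real (Suc (LEAST n. \<sigma> n \<noteq> \<tau> n)))"

definition cantor_metric :: "cantor metric" where
  "cantor_metric = metric (UNIV, cantor_dist)"

text \<open>The library's supremum metric; it is a maximum here, see \<open>mdist_cantor_maps_attained\<close> below.\<close>

definition cantor_maps :: "(cantor \<Rightarrow> cantor) metric" where
  "cantor_maps = cfunspace euclidean cantor_metric"

lemma cantor_dist_less_iff:
  "cantor_dist \<sigma> \<tau> < 1 / real (Suc n) \<longleftrightarrow> (\<forall>k\<le>n. \<sigma> k = \<tau> k)"
proof (cases "\<sigma> = \<tau>")
  case True
  then show ?thesis by (simp add: cantor_dist_def)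
next
  case False
  define m where "m = (LEAST n. \<sigma> n \<noteq> \<tau> n)"
  have "\<exists>n. \<sigma> n \<noteq> \<tau> n" using False by auto
  then have m: "\<sigma> m \<noteq> \<tau> m" unfolding m_def by (rule LeastI_ex)
  have m': "\<sigma> k = \<tau> k" if "k < m" for k
    using not_less_Least[of k "\<lambda>n. \<sigma> n \<noteq> \<tau> n"] that unfolding m_def by blast
  have "cantor_dist \<sigma> \<tau> < 1 / real (Suc n) \<longleftrightarrow> n < m"
  proof -
    have "cantor_dist \<sigma> \<tau> = 1 / real (Suc m)" using False unfolding cantor_dist_def m_def by simp
    then show ?thesis by (simp only:) (simp add: divide_simps)
  qed
  also have "\<dots> \<longleftrightarrow> (\<forall>k\<le>n. \<sigma> k = \<tau> k)"
    using m m' by (metis le_less_trans not_le)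
  finally show ?thesis .
qed

lemma cantor_dist_nonneg: "0 \<le> cantor_dist \<sigma> \<tau>"
  by (simp add: cantor_dist_def)

lemma cantor_dist_le_1: "cantor_dist \<sigma> \<tau> \<le> 1"
  by (simp add: cantor_dist_def)

lemma cantor_dist_eq_0_iff: "cantor_dist \<sigma> \<tau> = 0 \<longleftrightarrow> \<sigma> = \<tau>"
  by (simp add: cantor_dist_def)

lemma cantor_dist_commute: "cantor_dist \<sigma> \<tau> = cantor_dist \<tau> \<sigma>"
proof -
  have "(\<lambda>n. \<sigma> n \<noteq> \<tau> n) = (\<lambda>n. \<tau> n \<noteq> \<sigma> n)" by auto
  then show ?thesis by (auto simp: cantor_dist_def)
qed

lemma cantor_dist_ultra:
  "cantor_dist \<sigma> \<upsilon> \<le> max (cantor_dist \<sigma> \<tau>) (cantor_dist \<tau> \<upsilon>)"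
proof (rule ccontr)
  assume *: "\<not> ?thesis"
  then have "\<sigma> \<noteq> \<upsilon>" using cantor_dist_nonneg[of \<sigma> \<tau>] by (auto simp: cantor_dist_def[of \<sigma> \<upsilon>])
  then obtain n where n: "cantor_dist \<sigma> \<upsilon> = 1 / real (Suc n)"
    by (auto simp: cantor_dist_def)
  then have "\<forall>k\<le>n. \<sigma> k = \<tau> k" "\<forall>k\<le>n. \<tau> k = \<upsilon> k"
    using * by (metis cantor_dist_less_iff max_less_iff_conj not_le)+
  then have "cantor_dist \<sigma> \<upsilon> < 1 / real (Suc n)"
    unfolding cantor_dist_less_iff by simp
  with n show False by simp
qed

lemma Metric_space_cantor: "Metric_space UNIV cantor_dist"
proof
  show "cantor_dist \<sigma> \<upsilon> \<le> cantor_dist \<sigma> \<tau> + cantor_dist \<tau> \<upsilon>" for \<sigma> \<tau> \<upsilon>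
    using cantor_dist_ultra[of \<sigma> \<upsilon> \<tau>] cantor_dist_nonneg[of \<sigma> \<tau>] cantor_dist_nonneg[of \<tau> \<upsilon>]
    by linarith
qed (rule cantor_dist_nonneg cantor_dist_commute cantor_dist_eq_0_iff)+

lemma mspace_cantor_metric [simp]: "mspace cantor_metric = UNIV"
  and mdist_cantor_metric [simp]: "mdist cantor_metric = cantor_dist"
  by (simp_all add: cantor_metric_def Metric_space.mspace_metric[OF Metric_space_cantor]
      Metric_space.mdist_metric[OF Metric_space_cantor])

text \<open>The metric induces the product topology.\<close>

lemma open_cantor_iff:
  fixes U :: "cantor set"
  shows "open U \<longleftrightarrow> (\<forall>\<sigma>\<in>U. \<exists>n. \<forall>\<tau>. (\<forall>k\<le>n. \<sigma> k = \<tau> k) \<longrightarrow> \<tau> \<in> U)"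
proof
  assume U: "open U"
  show "\<forall>\<sigma>\<in>U. \<exists>n. \<forall>\<tau>. (\<forall>k\<le>n. \<sigma> k = \<tau> k) \<longrightarrow> \<tau> \<in> U"
  proof
    fix \<sigma> assume "\<sigma> \<in> U"
    with U obtain X where X: "\<sigma> \<in> Pi\<^sub>E UNIV X" "finite {i. X i \<noteq> UNIV}" "Pi\<^sub>E UNIV X \<subseteq> U"
      unfolding open_fun_def by (drule_tac product_topology_open_contains_basis) auto
    then obtain n where n: "\<And>i. X i \<noteq> UNIV \<Longrightarrow> i \<le> n"
      by (metis (mono_tags, lifting) finite_nat_set_iff_bounded_le mem_Collect_eq)
    have "\<tau> \<in> Pi\<^sub>E UNIV X" if "\<forall>k\<le>n. \<sigma> k = \<tau> k" for \<tau>
    proof -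
      have "\<tau> i \<in> X i" for i
      proof (cases "i \<le> n")
        case True
        moreover have "\<sigma> i \<in> X i" using X(1) by auto
        ultimately show ?thesis using that by simp
      qed (use n in blast)
      then show ?thesis by auto
    qed
    with X show "\<exists>n. \<forall>\<tau>. (\<forall>k\<le>n. \<sigma> k = \<tau> k) \<longrightarrow> \<tau> \<in> U" by blast
  qed
next
  assume *: "\<forall>\<sigma>\<in>U. \<exists>n. \<forall>\<tau>. (\<forall>k\<le>n. \<sigma> k = \<tau> k) \<longrightarrow> \<tau> \<in> U"
  show "open U"
  proof (subst open_subopen, rule ballI)
    fix \<sigma> assume "\<sigma> \<in> U"
    with * obtain n where n: "\<And>\<tau>. (\<forall>k\<le>n. \<sigma> k = \<tau> k) \<Longrightarrow> \<tau> \<in> U" by blast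
    define X where "X = (\<lambda>k. if k \<le> n then {\<sigma> k} else UNIV)"
    have "{k. X k \<noteq> UNIV} \<subseteq> {..n}" by (auto simp: X_def)
    then have "open (Pi\<^sub>E UNIV X)"
      by (intro open_PiE) (auto simp: X_def intro: finite_subset open_discrete)
    moreover have "\<sigma> \<in> Pi\<^sub>E UNIV X" by (auto simp: X_def)
    moreover have "Pi\<^sub>E UNIV X \<subseteq> U"
    proof
      fix \<tau> assume "\<tau> \<in> Pi\<^sub>E UNIV X"
      then have "\<tau> k \<in> X k" for k by auto
      then have "\<forall>k\<le>n. \<sigma> k = \<tau> k" unfolding X_def by (metis singletonD)
      then show "\<tau> \<in> U" by (rule n)
    qed
    ultimately show "\<exists>T. open T \<and> \<sigma> \<in> T \<and> T \<subseteq> U" by blast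
  qed
qed

lemma mtopology_of_cantor_metric [simp]: "mtopology_of cantor_metric = euclidean"
proof -
  interpret Metric_space UNIV cantor_dist by (rule Metric_space_cantor)
  have "openin mtopology U \<longleftrightarrow> open U" for U
  proof -
    have "(\<exists>r>0. mball \<sigma> r \<subseteq> U) \<longleftrightarrow> (\<exists>n. \<forall>\<tau>. (\<forall>k\<le>n. \<sigma> k = \<tau> k) \<longrightarrow> \<tau> \<in> U)" for \<sigma>
    proof
      assume "\<exists>r>0. mball \<sigma> r \<subseteq> U"
      then obtain r where r: "r > 0" "mball \<sigma> r \<subseteq> U" by blast
      then obtain n where "1 / real (Suc n) < r"
        using nat_approx_posE by blast
      then have "\<tau> \<in> mball \<sigma> r" if "\<forall>k\<le>n. \<sigma> k = \<tau> k" for \<tau>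
        using that cantor_dist_less_iff[of \<sigma> \<tau> n] by simp
      with r show "\<exists>n. \<forall>\<tau>. (\<forall>k\<le>n. \<sigma> k = \<tau> k) \<longrightarrow> \<tau> \<in> U" by blast
    next
      assume "\<exists>n. \<forall>\<tau>. (\<forall>k\<le>n. \<sigma> k = \<tau> k) \<longrightarrow> \<tau> \<in> U"
      then obtain n where "\<forall>\<tau>. (\<forall>k\<le>n. \<sigma> k = \<tau> k) \<longrightarrow> \<tau> \<in> U" by blast
      then have "mball \<sigma> (1 / real (Suc n)) \<subseteq> U"
        using cantor_dist_less_iff[of \<sigma> _ n] by (auto simp del: of_nat_Suc)
      then show "\<exists>r>0. mball \<sigma> r \<subseteq> U"
        by (meson of_nat_0_less_iff zero_less_Suc zero_less_divide_1_iff)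
    qed
    then show ?thesis by (simp add: openin_mtopology open_cantor_iff Ball_def)
  qed
  then have "mtopology = euclidean" by (simp add: topology_eq)
  then show ?thesis by (simp add: mtopology_of_def)
qed

lemma mspace_cantor_maps: "mspace cantor_maps = {f. continuous_on UNIV f}"
proof -
  interpret Metric_space UNIV cantor_dist by (rule Metric_space_cantor)
  have "mbounded S" for S
    unfolding mbounded_def
    by (rule exI[of _ "\<lambda>_. False"], rule exI[of _ 1]) (auto simp: cantor_dist_le_1)
  then show ?thesis by (auto simp: cantor_maps_def)
qed

lemma mdist_cantor_maps:
  assumes "continuous_on UNIV f" "continuous_on UNIV g"
  shows "mdist cantor_maps f g = (SUP \<sigma>. cantor_dist (f \<sigma>) (g \<sigma>))"
proof -
  interpret Metric_space UNIV cantor_dist by (rule Metric_space_cantor)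
  have "mbounded S" for S
    unfolding mbounded_def
    by (rule exI[of _ "\<lambda>_. False"], rule exI[of _ 1]) (auto simp: cantor_dist_le_1)
  then show ?thesis
    by (simp add: cantor_maps_def mdist_cfunspace_eq_mdist_funspace fdist_def fspace_def)
qed

lemma mdist_cantor_maps_attained:
  assumes "continuous_on UNIV f" "continuous_on UNIV g"
  shows "\<exists>\<sigma>. mdist cantor_maps f g = cantor_dist (f \<sigma>) (g \<sigma>)"
proof (cases "f = g")
  case True
  then show ?thesis using assms by (simp add: mdist_cantor_maps cantor_dist_def)
next
  case False
  define n where "n = (LEAST n. \<exists>\<sigma>. f \<sigma> n \<noteq> g \<sigma> n)"
  have "\<exists>n \<sigma>. f \<sigma> n \<noteq> g \<sigma> n" using False by (auto simp: fun_eq_iff)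
  then have "\<exists>\<sigma>. f \<sigma> n \<noteq> g \<sigma> n" unfolding n_def by (rule LeastI_ex)
  then obtain \<sigma> where \<sigma>: "f \<sigma> n \<noteq> g \<sigma> n" by blast
  have n_le: "n \<le> k" if "f \<tau> k \<noteq> g \<tau> k" for \<tau> k
    unfolding n_def using that by (blast intro: Least_le)
  have "cantor_dist (f \<tau>) (g \<tau>) \<le> cantor_dist (f \<sigma>) (g \<sigma>)" for \<tau>
  proof (cases "f \<tau> = g \<tau>")
    case True
    then show ?thesis by (simp add: cantor_dist_def)
  next
    case False
    have "(LEAST k. f \<sigma> k \<noteq> g \<sigma> k) \<le> (LEAST k. f \<tau> k \<noteq> g \<tau> k)"
    proof -
      have "(LEAST k. f \<sigma> k \<noteq> g \<sigma> k) \<le> n" using \<sigma> by (rule Least_le)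
      moreover have "\<exists>k. f \<tau> k \<noteq> g \<tau> k" using False by auto
      then have "f \<tau> (LEAST k. f \<tau> k \<noteq> g \<tau> k) \<noteq> g \<tau> (LEAST k. f \<tau> k \<noteq> g \<tau> k)"
        by (rule LeastI_ex)
      ultimately show ?thesis using n_le by (meson order_trans)
    qed
    moreover have "f \<sigma> \<noteq> g \<sigma>" using \<sigma> by auto
    ultimately show ?thesis using False by (simp add: cantor_dist_def frac_le)
  qed
  then have "(SUP \<tau>. cantor_dist (f \<tau>) (g \<tau>)) = cantor_dist (f \<sigma>) (g \<sigma>)"
    by (intro cSup_eq_maximum) auto
  then show ?thesis using assms by (auto simp: mdist_cantor_maps)
qed

definition nowhere_dense_in :: "'a topology \<Rightarrow> 'a set \<Rightarrow> bool" where
  "nowhere_dense_in X S \<longleftrightarrow> S \<subseteq> topspace X \<and> X interior_of (X closure_of S) = {}"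

definition meager_in :: "'a topology \<Rightarrow> 'a set \<Rightarrow> bool" where
  "meager_in X S \<longleftrightarrow> (\<exists>\<N>. countable \<N> \<and> (\<forall>N\<in>\<N>. nowhere_dense_in X N) \<and> S = \<Union>\<N>)"

definition comeager_in :: "'a topology \<Rightarrow> 'a set \<Rightarrow> bool" where
  "comeager_in X S \<longleftrightarrow> S \<subseteq> topspace X \<and> meager_in X (topspace X - S)"

definition omega_limit :: "'a::topological_space \<Rightarrow> ('a \<Rightarrow> 'a) \<Rightarrow> 'a set" where
  "omega_limit x f =
     {y. \<exists>r::nat \<Rightarrow> nat. strict_mono r \<and> ((\<lambda>n. (f ^^ Suc n) x) \<circ> r) \<longlonglongrightarrow> y}"

definition topologically_conjugate ::
  "'a topology \<Rightarrow> ('a \<Rightarrow> 'a) \<Rightarrow> 'b topology \<Rightarrow> ('b \<Rightarrow> 'b) \<Rightarrow> bool" where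
  "topologically_conjugate X f Y g \<longleftrightarrow>
     f \<in> topspace X \<rightarrow> topspace X \<and> g \<in> topspace Y \<rightarrow> topspace Y \<and>
     (\<exists>\<theta> \<theta>'. homeomorphic_maps X Y \<theta> \<theta>' \<and> (\<forall>x\<in>topspace X. f x = \<theta>' (g (\<theta> x))))"

definition odometer_space :: "(nat \<Rightarrow> nat) \<Rightarrow> (nat \<Rightarrow> nat) topology" where
  "odometer_space \<alpha> = product_topology (\<lambda>i. discrete_topology {..<\<alpha> i}) UNIV"

text \<open>\<open>carry \<alpha> x y i\<close> is the carry into position \<open>i\<close>.\<close>

fun carry :: "(nat \<Rightarrow> nat) \<Rightarrow> (nat \<Rightarrow> nat) \<Rightarrow> (nat \<Rightarrow> nat) \<Rightarrow> nat \<Rightarrow> nat" where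
  "carry \<alpha> x y 0 = 0"
| "carry \<alpha> x y (Suc i) = (if x i + y i + carry \<alpha> x y i < \<alpha> i then 0 else 1)"

definition odometer_add :: "(nat \<Rightarrow> nat) \<Rightarrow> (nat \<Rightarrow> nat) \<Rightarrow> (nat \<Rightarrow> nat) \<Rightarrow> (nat \<Rightarrow> nat)" where
  "odometer_add \<alpha> x y = (\<lambda>i. (x i + y i + carry \<alpha> x y i) mod \<alpha> i)"

definition odometer :: "(nat \<Rightarrow> nat) \<Rightarrow> (nat \<Rightarrow> nat) \<Rightarrow> (nat \<Rightarrow> nat)" where
  "odometer \<alpha> x = odometer_add \<alpha> x (\<lambda>i. if i = 0 then 1 else 0)"

definition odometer_mult :: "(nat \<Rightarrow> nat) \<Rightarrow> nat \<Rightarrow> enat" where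
  "odometer_mult \<alpha> p = (\<Sum>i. enat (multiplicity p (\<alpha> i)))"

definition universal_odometer_seq :: "(nat \<Rightarrow> nat) \<Rightarrow> bool" where
  "universal_odometer_seq \<alpha> \<longleftrightarrow> (\<forall>i. 2 \<le> \<alpha> i) \<and> (\<forall>p. prime p \<longrightarrow> odometer_mult \<alpha> p = \<infinity>)"

lemma odometer_mult_eq_SUP:
  "odometer_mult \<alpha> p = (SUP n. \<Sum>i<n. enat (multiplicity p (\<alpha> i)))"
proof -
  have "incseq (\<lambda>n. \<Sum>i<n. enat (multiplicity p (\<alpha> i)))"
    by (intro incseq_SucI) simp
  then have "(\<lambda>i. enat (multiplicity p (\<alpha> i))) sums (SUP n. \<Sum>i<n. enat (multiplicity p (\<alpha> i)))"
    unfolding sums_def by (rule LIMSEQ_SUP)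
  then show ?thesis unfolding odometer_mult_def by (rule sums_unique[symmetric])
qed

text \<open>
  All universal odometers are topologically conjugate to each other, so statements about
  ``the'' universal odometer are quantified over all \<open>\<alpha>\<close> with this property, and such \<open>\<alpha>\<close> exist:
\<close>

lemma universal_odometer_seq_fact: "universal_odometer_seq (\<lambda>i. fact (i + 2))"
  unfolding universal_odometer_seq_def
proof (intro conjI allI impI)
  fix i :: nat
  have "fact 2 \<le> (fact (i + 2) :: nat)" by (intro fact_mono_nat) simp
  then show "2 \<le> (fact (i + 2) :: nat)" by (simp add: fact_numeral)
next
  fix p :: nat assume p: "prime p"
  have mult: "1 \<le> multiplicity p (fact (i + 2) :: nat)" if "p \<le> i" for i
  proof -
    have "p dvd (fact (i + 2) :: nat)" using that p by (simp add: prime_dvd_fact_iff del: fact_Suc add_2_eq_Suc')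
    then show ?thesis
      using prime_multiplicity_gt_zero_iff[OF prime_imp_prime_elem[OF p], of "fact (i + 2) :: nat"]
      by (simp add: Suc_le_eq del: fact_Suc add_2_eq_Suc')
  qed
  have "enat m \<le> odometer_mult (\<lambda>i. fact (i + 2)) p" for m
  proof -
    have "m = (\<Sum>i\<in>{p..<p + m}. 1)" by simp
    also have "\<dots> \<le> (\<Sum>i\<in>{p..<p + m}. multiplicity p (fact (i + 2) :: nat))"
      by (intro sum_mono mult) simp
    also have "\<dots> \<le> (\<Sum>i<p + m. multiplicity p (fact (i + 2) :: nat))"
      by (intro sum_mono2) auto
    finally have "enat m \<le> enat (\<Sum>i<p + m. multiplicity p (fact (i + 2) :: nat))" by simp
    also have "\<dots> = (\<Sum>i<p + m. enat (multiplicity p (fact (i + 2) :: nat)))"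
      by (simp add: of_nat_eq_enat[symmetric] of_nat_sum)
    also have "\<dots> \<le> odometer_mult (\<lambda>i. fact (i + 2)) p"
      unfolding odometer_mult_eq_SUP by (rule SUP_upper) simp
    finally show ?thesis .
  qed
  then show "odometer_mult (\<lambda>i. fact (i + 2)) p = \<infinity>"
    by (metis enat_ord_simps(1) not_infinity_eq Suc_n_not_le_n)
qed

end

theory Submission
  imports Defs
begin

text \<open>
  Call \<open>c\<close> a clock of period \<open>N\<close> for \<open>f\<close> at level \<open>l\<close> if both \<open>c \<sigma>\<close> and the first \<open>l\<close> entries of
  \<open>f \<sigma>\<close> depend only on the first \<open>l\<close> entries of \<open>\<sigma>\<close>, and each application of \<open>f\<close> advances
  \<open>c\<close> by one modulo \<open>N\<close>. The comeager set consists of the continuous maps that have, for every \<open>m\<close>,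
  a clock of period \<open>fact m\<close> at some level \<open>l \<ge> m\<close>.

  This set is comeager because, for a fixed \<open>m\<close>, a clock of \<open>f\<close> at level \<open>l\<close> is also a clock of every
  map that agrees with \<open>f\<close> in the first \<open>l\<close> output entries (\<open>openin_clock_maps\<close>), and because any
  continuous map can be given a clock by rewriting only its output entries from some index on: a block
  of those entries is made to store the current time in one-hot code
  (\<open>clock_map_approximates\<close>).

  Now let \<open>f\<close> have all these clocks and compare two sequences indexed by time \<open>n\<close>: the orbit
  \<open>(f ^^ n) \<sigma>\<close>, and the mixed-radix digits of \<open>n\<close>, which are the odometer orbit of zero. The clocks
  show that a long prefix of an orbit point determines many digits of \<open>n\<close>. Conversely, at the level
  of a clock the prefixes form an orbit of a map of a finite set, so they are eventually periodic, and
  for a universal odometer the period divides some partial product of the radices; hence sufficiently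
  many digits of \<open>n\<close> determine the prefix, once \<open>n\<close> is large. Two orbits that determine each other in
  this sense have conjugate sets of cluster points, the graph of the conjugacy being the set of joint
  cluster points (\<open>conjugate_on_cluster_points\<close>). The cluster points of the first orbit are the
  \<open>\<omega>\<close>-limit set, those of the second are the whole odometer space.
\<close>

section \<open>Sequences agreeing on an initial segment\<close>

definition agree :: "nat \<Rightarrow> (nat \<Rightarrow> 'a) \<Rightarrow> (nat \<Rightarrow> 'a) \<Rightarrow> bool" where
  "agree n x y \<longleftrightarrow> (\<forall>i<n. x i = y i)"

lemma agree_refl [simp]: "agree n x x"
  by (simp add: agree_def)

lemma agree_sym: "agree n x y \<Longrightarrow> agree n y x"
  by (simp add: agree_def)

lemma agree_trans: "agree n x y \<Longrightarrow> agree n y z \<Longrightarrow> agree n x z"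
  by (simp add: agree_def)

lemma agree_mono: "agree n x y \<Longrightarrow> m \<le> n \<Longrightarrow> agree m x y"
  by (simp add: agree_def)

lemma eq_if_agree: "(\<And>n. agree n x y) \<Longrightarrow> x = y"
  by (auto simp: agree_def fun_eq_iff)

lemma open_agree:
  fixes x :: "nat \<Rightarrow> 'a::discrete_topology"
  shows "open {y. agree n x y}"
proof -
  have "{y. agree n x y} = Pi\<^sub>E UNIV (\<lambda>i. if i < n then {x i} else UNIV)"
    by (auto simp: agree_def PiE_def Pi_def split: if_splits)
  moreover have "open \<dots>"
    by (rule open_PiE) (auto simp: open_discrete intro: finite_subset[of _ "{..<n}"])
  ultimately show ?thesis by simp
qed

lemma tendsto_iff_eventually_agree:
  fixes x :: "nat \<Rightarrow> nat \<Rightarrow> 'a::discrete_topology"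
  shows "x \<longlonglongrightarrow> y \<longleftrightarrow> (\<forall>n. \<forall>\<^sub>F k in sequentially. agree n (x k) y)"
proof
  assume lim: "x \<longlonglongrightarrow> y"
  show "\<forall>n. \<forall>\<^sub>F k in sequentially. agree n (x k) y"
  proof
    fix n
    have "\<forall>\<^sub>F k in sequentially. x k \<in> {z. agree n y z}"
      using lim by (rule topological_tendstoD) (simp_all add: open_agree)
    then show "\<forall>\<^sub>F k in sequentially. agree n (x k) y"
      by eventually_elim (simp add: agree_sym)
  qed
next
  assume ev: "\<forall>n. \<forall>\<^sub>F k in sequentially. agree n (x k) y"
  have "(\<lambda>k. x k i) \<longlonglongrightarrow> y i" for i
  proof (rule tendsto_eventually)
    have "\<forall>\<^sub>F k in sequentially. agree (Suc i) (x k) y" using ev by blast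
    then show "\<forall>\<^sub>F k in sequentially. x k i = y i"
      by eventually_elim (simp add: agree_def)
  qed
  then have "limitin (product_topology (\<lambda>_. euclidean) UNIV) x y sequentially"
    by (simp add: limitin_componentwise)
  then show "x \<longlonglongrightarrow> y" by (simp add: euclidean_product_topology)
qed

lemma continuous_on_if_agree:
  fixes \<theta> :: "(nat \<Rightarrow> 'a::discrete_topology) \<Rightarrow> (nat \<Rightarrow> 'b::discrete_topology)"
  assumes "\<And>L. \<exists>K. \<forall>y\<in>S. \<forall>z\<in>S. agree K y z \<longrightarrow> agree L (\<theta> y) (\<theta> z)"
  shows "continuous_on S \<theta>"
proof (rule continuous_on_coordinatewise_then_product)
  fix i
  obtain K where K: "\<And>y z. y \<in> S \<Longrightarrow> z \<in> S \<Longrightarrow> agree K y z \<Longrightarrow> agree (Suc i) (\<theta> y) (\<theta> z)"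
    using assms by meson
  show "continuous_on S (\<lambda>y. \<theta> y i)"
    unfolding continuous_on_def
  proof
    fix y assume y: "y \<in> S"
    have "\<forall>\<^sub>F z in at y within S. z \<in> {z. agree K y z}"
      using tendsto_ident_at open_agree by (rule topological_tendstoD) simp
    moreover have "\<forall>\<^sub>F z in at y within S. z \<in> S"
      by (simp add: eventually_at_filter)
    ultimately have "\<forall>\<^sub>F z in at y within S. \<theta> z i = \<theta> y i"
      by eventually_elim (use K[OF y] in \<open>simp add: agree_def\<close>)
    then show "((\<lambda>z. \<theta> z i) \<longlongrightarrow> \<theta> y i) (at y within S)"
      by (rule tendsto_eventually)
  qed
qed

lemma open_iff_agree:
  fixes U :: "cantor set"
  shows "open U \<longleftrightarrow> (\<forall>\<sigma>\<in>U. \<exists>n. \<forall>\<tau>. agree n \<sigma> \<tau> \<longrightarrow> \<tau> \<in> U)"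
proof -
  have "(\<exists>n. \<forall>\<tau>. (\<forall>k\<le>n. \<sigma> k = \<tau> k) \<longrightarrow> \<tau> \<in> U) \<longleftrightarrow> (\<exists>n. \<forall>\<tau>. agree n \<sigma> \<tau> \<longrightarrow> \<tau> \<in> U)" for \<sigma>
  proof
    assume "\<exists>n. \<forall>\<tau>. (\<forall>k\<le>n. \<sigma> k = \<tau> k) \<longrightarrow> \<tau> \<in> U"
    then show "\<exists>n. \<forall>\<tau>. agree n \<sigma> \<tau> \<longrightarrow> \<tau> \<in> U"
      unfolding agree_def by (metis less_Suc_eq_le)
  next
    assume "\<exists>n. \<forall>\<tau>. agree n \<sigma> \<tau> \<longrightarrow> \<tau> \<in> U"
    then show "\<exists>n. \<forall>\<tau>. (\<forall>k\<le>n. \<sigma> k = \<tau> k) \<longrightarrow> \<tau> \<in> U"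
      unfolding agree_def by (metis less_imp_le)
  qed
  then show ?thesis unfolding open_cantor_iff by simp
qed

lemma compact_cantor: "compact (UNIV :: cantor set)"
proof -
  have "compact_space (euclidean :: bool topology)"
    by (simp add: compact_space_def finite_imp_compact)
  then have "compact_space (product_topology (\<lambda>_::nat. euclidean :: bool topology) UNIV)"
    by (simp add: compact_space_product_topology)
  then show ?thesis
    by (simp add: euclidean_product_topology compact_space_def)
qed

text \<open>
  Compactness gives finitely many cylinders covering the space, on each of which the first \<open>m\<close> output
  entries are constant; the longest of their prefix lengths works everywhere.
\<close>

lemma uniformly_continuous_agree:
  fixes f :: "cantor \<Rightarrow> cantor"
  assumes f: "continuous_on UNIV f"
  shows "\<exists>l. \<forall>\<sigma> \<tau>. agree l \<sigma> \<tau> \<longrightarrow> agree m (f \<sigma>) (f \<tau>)"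
proof -
  have "\<exists>n. \<forall>\<tau>. agree n \<sigma> \<tau> \<longrightarrow> agree m (f \<sigma>) (f \<tau>)" for \<sigma>
  proof -
    have "open (f -` {\<upsilon>. agree m (f \<sigma>) \<upsilon>})"
      using open_agree f by (rule open_vimage)
    moreover have "\<sigma> \<in> f -` {\<upsilon>. agree m (f \<sigma>) \<upsilon>}" by simp
    ultimately show ?thesis unfolding open_iff_agree by blast
  qed
  then obtain n where n: "\<And>\<sigma> \<tau>. agree (n \<sigma>) \<sigma> \<tau> \<Longrightarrow> agree m (f \<sigma>) (f \<tau>)" by metis
  have cover: "UNIV \<subseteq> (\<Union>\<sigma>. {\<tau>. agree (n \<sigma>) \<sigma> \<tau>})" using agree_refl by blast
  obtain C where C: "finite C" "UNIV \<subseteq> (\<Union>\<sigma>\<in>C. {\<tau>. agree (n \<sigma>) \<sigma> \<tau>})"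
    by (rule compactE_image[OF compact_cantor open_agree cover])
  have "agree m (f \<rho>) (f \<tau>)" if *: "agree (Max (n ` C)) \<rho> \<tau>" for \<rho> \<tau>
  proof -
    obtain \<sigma> where \<sigma>: "\<sigma> \<in> C" "agree (n \<sigma>) \<sigma> \<rho>" using C(2) by blast
    then have "agree (n \<sigma>) \<rho> \<tau>" using C(1) by (intro agree_mono[OF *]) simp
    with \<sigma> n show ?thesis by (meson agree_sym agree_trans)
  qed
  then show ?thesis by blast
qed

section \<open>Cluster points of sequences that determine each other\<close>

definition cluster_points :: "(nat \<Rightarrow> nat \<Rightarrow> 'a) \<Rightarrow> (nat \<Rightarrow> 'a) set" where
  "cluster_points a = {y. \<forall>L. \<exists>n\<ge>L. agree L (a n) y}"

definition joint_cluster_point ::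
  "(nat \<Rightarrow> nat \<Rightarrow> 'a) \<Rightarrow> (nat \<Rightarrow> nat \<Rightarrow> 'b) \<Rightarrow> (nat \<Rightarrow> 'a) \<Rightarrow> (nat \<Rightarrow> 'b) \<Rightarrow> bool" where
  "joint_cluster_point a b y x \<longleftrightarrow> (\<forall>L. \<exists>n\<ge>L. agree L (a n) y \<and> agree L (b n) x)"

text \<open>
  The bound \<open>N\<close> is essential for orbits: a prefix of an orbit point is determined by the time modulo a
  period only after the transient part of the orbit.
\<close>

definition determines :: "(nat \<Rightarrow> nat \<Rightarrow> 'a) \<Rightarrow> (nat \<Rightarrow> nat \<Rightarrow> 'b) \<Rightarrow> bool" where
  "determines a b \<longleftrightarrow>
     (\<forall>L. \<exists>K N. \<forall>m\<ge>N. \<forall>n\<ge>N. agree K (a m) (a n) \<longrightarrow> agree L (b m) (b n))"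

lemma joint_cluster_point_commute:
  "joint_cluster_point a b y x \<longleftrightarrow> joint_cluster_point b a x y"
  unfolding joint_cluster_point_def by (simp add: conj_commute)

lemma joint_cluster_pointD: "joint_cluster_point a b y x \<Longrightarrow> y \<in> cluster_points a"
  unfolding joint_cluster_point_def cluster_points_def by blast

text \<open>
  Along times at which \<open>a\<close> approaches \<open>y\<close>, longer and longer prefixes of \<open>b\<close> are eventually constant,
  so \<open>b\<close> converges there; its limit is the partner \<open>x\<close>.
\<close>

lemma joint_cluster_point_exists:
  assumes "determines a b" "y \<in> cluster_points a"
  shows "\<exists>x. joint_cluster_point a b y x"
proof -
  have "\<forall>k. \<exists>n\<ge>k. agree k (a n) y" using assms(2) unfolding cluster_points_def by simp
  then obtain n where n: "\<And>k. k \<le> n k" "\<And>k. agree k (a (n k)) y" by metis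
  have "\<exists>h. \<forall>j\<ge>h. \<forall>k\<ge>h. agree L (b (n j)) (b (n k))" for L
  proof -
    obtain K N where KN: "\<And>p q. N \<le> p \<Longrightarrow> N \<le> q \<Longrightarrow> agree K (a p) (a q) \<Longrightarrow> agree L (b p) (b q)"
      using assms(1) unfolding determines_def by meson
    have "agree L (b (n j)) (b (n k))" if "max K N \<le> j" "max K N \<le> k" for j k
    proof (rule KN)
      show "N \<le> n j" "N \<le> n k" using that n(1)[of j] n(1)[of k] by linarith+
      have "agree K (a (n j)) y" "agree K (a (n k)) y"
        using that by (auto intro: agree_mono[OF n(2)])
      then show "agree K (a (n j)) (a (n k))" by (meson agree_sym agree_trans)
    qed
    then show ?thesis by blast
  qed
  then obtain h where h: "\<And>L j k. h L \<le> j \<Longrightarrow> h L \<le> k \<Longrightarrow> agree L (b (n j)) (b (n k))" by metis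
  define x where "x = (\<lambda>i. b (n (h (Suc i))) i)"
  have "\<exists>p\<ge>L. agree L (a p) y \<and> agree L (b p) x" for L
  proof -
    \<comment> \<open>The sum merely serves as a bound for all \<open>h (Suc i)\<close> with \<open>i < L\<close>.\<close>
    define k where "k = L + (\<Sum>i<L. h (Suc i))"
    have "b (n k) i = x i" if "i < L" for i
    proof -
      have "h (Suc i) \<le> (\<Sum>i<L. h (Suc i))" using that by (intro member_le_sum) auto
      then have "h (Suc i) \<le> k" unfolding k_def by simp
      then have "agree (Suc i) (b (n k)) (b (n (h (Suc i))))" by (rule h) simp
      then show ?thesis by (simp add: agree_def x_def)
    qed
    moreover have "L \<le> k" by (simp add: k_def)
    ultimately show ?thesis
      using n(1)[of k] agree_mono[OF n(2)[of k]] by (auto simp: agree_def intro!: exI[of _ "n k"])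
  qed
  then show ?thesis unfolding joint_cluster_point_def by blast
qed

text \<open>
  The correspondence between partners is uniformly continuous. With \<open>y = z\<close> this also shows that a
  partner is unique.
\<close>

lemma joint_cluster_point_agree:
  assumes "determines a b"
  shows "\<exists>K. \<forall>y z x w. joint_cluster_point a b y x \<longrightarrow> joint_cluster_point a b z w \<longrightarrow>
           agree K y z \<longrightarrow> agree L x w"
proof -
  obtain K N where KN: "\<And>p q. N \<le> p \<Longrightarrow> N \<le> q \<Longrightarrow> agree K (a p) (a q) \<Longrightarrow> agree L (b p) (b q)"
    using assms(1) unfolding determines_def by meson
  have "agree L x w" if yx: "joint_cluster_point a b y x" and zw: "joint_cluster_point a b z w"
    and yz: "agree K y z" for y z x w
  proof -
    define M where "M = max L (max K N)"
    have M: "L \<le> M" "K \<le> M" "N \<le> M" by (auto simp: M_def)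
    obtain p where p: "M \<le> p" "agree M (a p) y" "agree M (b p) x"
      using yx unfolding joint_cluster_point_def by meson
    obtain q where q: "M \<le> q" "agree M (a q) z" "agree M (b q) w"
      using zw unfolding joint_cluster_point_def by meson
    have "agree K (a p) (a q)"
      using p(2) q(2) yz M(2) by (meson agree_mono agree_sym agree_trans)
    then have "agree L (b p) (b q)" using p(1) q(1) M(3) by (intro KN) auto
    then show ?thesis
      using p(3) q(3) M(1) by (meson agree_mono agree_sym agree_trans)
  qed
  then show ?thesis by blast
qed

lemma joint_cluster_point_unique:
  assumes "determines a b" "joint_cluster_point a b y x" "joint_cluster_point a b y w"
  shows "x = w"
proof (rule eq_if_agree)
  fix L
  obtain K where "\<And>y z x w. joint_cluster_point a b y x \<Longrightarrow> joint_cluster_point a b z w \<Longrightarrow>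
      agree K y z \<Longrightarrow> agree L x w"
    using joint_cluster_point_agree[OF assms(1), of L] by blast
  then show "agree L x w" using assms(2,3) by simp
qed

lemma joint_cluster_point_step:
  assumes a: "\<And>n. a (Suc n) = F (a n)" and b: "\<And>n. b (Suc n) = G (b n)"
    and F: "\<And>L. \<exists>K. \<forall>y z. agree K y z \<longrightarrow> agree L (F y) (F z)"
    and G: "\<And>L. \<exists>K. \<forall>y z. agree K y z \<longrightarrow> agree L (G y) (G z)"
    and yx: "joint_cluster_point a b y x"
  shows "joint_cluster_point a b (F y) (G x)"
  unfolding joint_cluster_point_def
proof
  fix L
  obtain K where K: "\<And>y z. agree K y z \<Longrightarrow> agree L (F y) (F z)" using F by meson
  obtain K' where K': "\<And>y z. agree K' y z \<Longrightarrow> agree L (G y) (G z)" using G by meson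
  obtain n where n: "max L (max K K') \<le> n" "agree (max L (max K K')) (a n) y"
      "agree (max L (max K K')) (b n) x"
    using yx unfolding joint_cluster_point_def by meson
  have "agree L (a (Suc n)) (F y)" unfolding a using n(2) by (intro K) (rule agree_mono, auto)
  moreover have "agree L (b (Suc n)) (G x)" unfolding b using n(3) by (intro K') (rule agree_mono, auto)
  moreover have "L \<le> Suc n" using n(1) by simp
  ultimately show "\<exists>n\<ge>L. agree L (a n) (F y) \<and> agree L (b n) (G x)" by blast
qed

text \<open>
  The joint cluster points form the graph of a bijection, since each of the two sequences determines
  the other; it is a homeomorphism by uniform continuity in both directions, and equivariant because
  moving one step forward in time turns a joint cluster point \<open>(y, x)\<close> into \<open>(F y, G x)\<close>.
\<close>

theorem conjugate_on_cluster_points: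
  fixes a :: "nat \<Rightarrow> nat \<Rightarrow> 'a::discrete_topology" and b :: "nat \<Rightarrow> nat \<Rightarrow> 'b::discrete_topology"
  assumes ab: "determines a b" and ba: "determines b a"
    and a: "\<And>n. a (Suc n) = F (a n)" and b: "\<And>n. b (Suc n) = G (b n)"
    and F: "\<And>L. \<exists>K. \<forall>y z. agree K y z \<longrightarrow> agree L (F y) (F z)"
    and G: "\<And>L. \<exists>K. \<forall>y z. agree K y z \<longrightarrow> agree L (G y) (G z)"
  shows "topologically_conjugate (top_of_set (cluster_points a)) (restrict F (cluster_points a))
           (top_of_set (cluster_points b)) G"
proof -
  let ?A = "cluster_points a" and ?B = "cluster_points b" and ?J = "joint_cluster_point a b"
  note commute = joint_cluster_point_commute[of a b]
  have ex: "\<exists>x. ?J y x" if "y \<in> ?A" for y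
    using that by (rule joint_cluster_point_exists[OF ab])
  have ex': "\<exists>y. ?J y x" if "x \<in> ?B" for x
    using that joint_cluster_point_exists[OF ba] commute by blast
  have unique: "x = w" if "?J y x" "?J y w" for y x w
    using that by (rule joint_cluster_point_unique[OF ab])
  have unique': "y = z" if "?J y x" "?J z x" for y z x
    using that joint_cluster_point_unique[OF ba] commute by blast
  have in_A: "y \<in> ?A" and in_B: "x \<in> ?B" if "?J y x" for y x
    using that commute by (auto dest: joint_cluster_pointD)
  have step: "?J (F y) (G x)" if "?J y x" for y x
    using a b F G that by (rule joint_cluster_point_step)
  define \<theta> where "\<theta> = (\<lambda>y. SOME x. ?J y x)"
  define \<theta>' where "\<theta>' = (\<lambda>x. SOME y. ?J y x)"
  have \<theta>: "?J y (\<theta> y)" if "y \<in> ?A" for y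
    unfolding \<theta>_def using ex[OF that] by (rule someI_ex)
  have \<theta>': "?J (\<theta>' x) x" if "x \<in> ?B" for x
    unfolding \<theta>'_def using ex'[OF that] by (rule someI_ex)
  have \<theta>_in: "\<theta> y \<in> ?B" if "y \<in> ?A" for y
    using \<theta>[OF that] by (rule in_B)
  have \<theta>'_in: "\<theta>' x \<in> ?A" if "x \<in> ?B" for x
    using \<theta>'[OF that] by (rule in_A)
  have inverse: "\<theta>' (\<theta> y) = y" if "y \<in> ?A" for y
    using \<theta>'[OF \<theta>_in[OF that]] \<theta>[OF that] by (rule unique')
  have inverse': "\<theta> (\<theta>' x) = x" if "x \<in> ?B" for x
    using \<theta>[OF \<theta>'_in[OF that]] \<theta>'[OF that] by (rule unique)
  have "continuous_on ?A \<theta>"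
  proof (rule continuous_on_if_agree)
    show "\<exists>K. \<forall>y\<in>?A. \<forall>z\<in>?A. agree K y z \<longrightarrow> agree L (\<theta> y) (\<theta> z)" for L
      using joint_cluster_point_agree[OF ab, of L] \<theta> by meson
  qed
  moreover have "continuous_on ?B \<theta>'"
  proof (rule continuous_on_if_agree)
    show "\<exists>K. \<forall>y\<in>?B. \<forall>z\<in>?B. agree K y z \<longrightarrow> agree L (\<theta>' y) (\<theta>' z)" for L
      using joint_cluster_point_agree[OF ba, of L] \<theta>' commute by meson
  qed
  ultimately have "homeomorphic_maps (top_of_set ?A) (top_of_set ?B) \<theta> \<theta>'"
    using \<theta>_in \<theta>'_in inverse inverse' by (simp add: homeomorphic_maps_def Pi_def)
  moreover have "F y = \<theta>' (G (\<theta> y))" if "y \<in> ?A" for y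
    using unique' step \<theta> \<theta>' in_B that by metis
  moreover have "F y \<in> ?A" if "y \<in> ?A" for y
    using in_A step \<theta> that by metis
  moreover have "G x \<in> ?B" if "x \<in> ?B" for x
    using in_B step \<theta>' that by metis
  ultimately show ?thesis
    unfolding topologically_conjugate_def by auto
qed

lemma omega_limit_eq_cluster_points:
  fixes f :: "(nat \<Rightarrow> 'a::discrete_topology) \<Rightarrow> (nat \<Rightarrow> 'a)"
  shows "omega_limit \<sigma> f = cluster_points (\<lambda>n. (f ^^ n) \<sigma>)"
proof (intro equalityI subsetI)
  fix y assume "y \<in> omega_limit \<sigma> f"
  then obtain r :: "nat \<Rightarrow> nat" where r: "strict_mono r" "(\<lambda>k. (f ^^ Suc (r k)) \<sigma>) \<longlonglongrightarrow> y"
    unfolding omega_limit_def by (auto simp: o_def)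
  show "y \<in> cluster_points (\<lambda>n. (f ^^ n) \<sigma>)"
    unfolding cluster_points_def
  proof (clarify)
    fix L
    have "\<forall>\<^sub>F k in sequentially. agree L ((f ^^ Suc (r k)) \<sigma>) y"
      using r(2) unfolding tendsto_iff_eventually_agree by blast
    then obtain k0 where k0: "\<And>k. k0 \<le> k \<Longrightarrow> agree L ((f ^^ Suc (r k)) \<sigma>) y"
      unfolding eventually_sequentially by blast
    have "L \<le> Suc (r (max k0 L))"
      using seq_suble[OF r(1), of "max k0 L"] by linarith
    with k0[of "max k0 L"] show "\<exists>n\<ge>L. agree L ((f ^^ n) \<sigma>) y" by (meson max.cobounded1)
  qed
next
  fix y assume y: "y \<in> cluster_points (\<lambda>n. (f ^^ n) \<sigma>)"
  have *: "\<exists>n\<ge>M. agree L ((f ^^ Suc n) \<sigma>) y" for L M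
  proof -
    obtain n where n: "Suc (max L M) \<le> n" "agree (Suc (max L M)) ((f ^^ n) \<sigma>) y"
      using y unfolding cluster_points_def by blast
    then obtain n' where "n = Suc n'" by (cases n) auto
    with n have "M \<le> n'" "agree L ((f ^^ Suc n') \<sigma>) y" by (auto intro: agree_mono simp del: funpow.simps)
    then show ?thesis by blast
  qed
  have "\<exists>r. \<forall>k. agree k ((f ^^ Suc (r k)) \<sigma>) y \<and> r k < r (Suc k)"
  proof (rule dependent_nat_choice)
    show "\<exists>n. agree 0 ((f ^^ Suc n) \<sigma>) y" by (simp add: agree_def)
    show "\<exists>n'. agree (Suc k) ((f ^^ Suc n') \<sigma>) y \<and> n < n'" for n k
      using *[of "Suc n" "Suc k"] by (auto simp: Suc_le_eq)
  qed
  then obtain r where r: "\<And>k. agree k ((f ^^ Suc (r k)) \<sigma>) y" "strict_mono r"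
    by (auto simp: strict_mono_Suc_iff)
  have "(\<lambda>k. (f ^^ Suc (r k)) \<sigma>) \<longlonglongrightarrow> y"
    unfolding tendsto_iff_eventually_agree
  proof
    show "\<forall>\<^sub>F k in sequentially. agree n ((f ^^ Suc (r k)) \<sigma>) y" for n
      using eventually_ge_at_top[of n] by eventually_elim (rule agree_mono[OF r(1)])
  qed
  with r(2) show "y \<in> omega_limit \<sigma> f"
    unfolding omega_limit_def by (auto simp: o_def)
qed

section \<open>Mixed-radix digits and the odometer\<close>

definition radix :: "(nat \<Rightarrow> nat) \<Rightarrow> nat \<Rightarrow> nat" where
  "radix \<alpha> k = (\<Prod>i<k. \<alpha> i)"

definition digits :: "(nat \<Rightarrow> nat) \<Rightarrow> nat \<Rightarrow> nat \<Rightarrow> nat" where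
  "digits \<alpha> n = (\<lambda>i. n div radix \<alpha> i mod \<alpha> i)"

lemma radix_0 [simp]: "radix \<alpha> 0 = 1"
  and radix_Suc [simp]: "radix \<alpha> (Suc k) = radix \<alpha> k * \<alpha> k"
  by (simp_all add: radix_def)

lemma radix_pos: "(\<And>i. 2 \<le> \<alpha> i) \<Longrightarrow> 0 < radix \<alpha> k"
  unfolding radix_def by (metis gr0I not_numeral_le_zero prod_pos)

lemma radix_dvd: "i \<le> k \<Longrightarrow> radix \<alpha> i dvd radix \<alpha> k"
  unfolding radix_def by (intro prod_dvd_prod_subset) auto

text \<open>
  The first \<open>k\<close> digits of \<open>n\<close> carry the same information as the residue of \<open>n\<close> modulo the product of
  the first \<open>k\<close> radices. All later arguments about digits go through this residue.
\<close>

lemma agree_digits_iff: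
  "agree k (digits \<alpha> m) (digits \<alpha> n) \<longleftrightarrow> m mod radix \<alpha> k = n mod radix \<alpha> k"
proof (induction k)
  case (Suc k)
  have split: "j mod radix \<alpha> (Suc k) = radix \<alpha> k * digits \<alpha> j k + j mod radix \<alpha> k" for j
    by (simp add: mod_mult2_eq digits_def)
  have "agree (Suc k) (digits \<alpha> m) (digits \<alpha> n) \<longleftrightarrow>
      agree k (digits \<alpha> m) (digits \<alpha> n) \<and> digits \<alpha> m k = digits \<alpha> n k"
    by (auto simp: agree_def less_Suc_eq)
  also have "\<dots> \<longleftrightarrow> m mod radix \<alpha> (Suc k) = n mod radix \<alpha> (Suc k)"
  proof
    assume "agree k (digits \<alpha> m) (digits \<alpha> n) \<and> digits \<alpha> m k = digits \<alpha> n k"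
    then show "m mod radix \<alpha> (Suc k) = n mod radix \<alpha> (Suc k)"
      unfolding split Suc.IH by simp
  next
    assume eq: "m mod radix \<alpha> (Suc k) = n mod radix \<alpha> (Suc k)"
    then have "m mod radix \<alpha> k = n mod radix \<alpha> k"
      by (metis mod_mod_cancel radix_dvd le_Suc_eq order_refl)
    moreover from eq this have "radix \<alpha> k * digits \<alpha> m k = radix \<alpha> k * digits \<alpha> n k"
      unfolding split by simp
    then have "digits \<alpha> m k = digits \<alpha> n k"
      by (cases "radix \<alpha> k = 0") (auto simp: digits_def)
    ultimately show "agree k (digits \<alpha> m) (digits \<alpha> n) \<and> digits \<alpha> m k = digits \<alpha> n k"
      using Suc.IH by simp
  qed
  finally show ?case .
qed (simp add: agree_def)

text \<open>
  Adding one to \<open>n\<close> changes the digit at position \<open>i\<close> exactly when all lower digits overflow, that is,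
  when \<open>Suc n\<close> is a multiple of \<open>radix \<alpha> i\<close>. The summand for \<open>i = 0\<close> is the added unit, treated as
  a carry into the lowest position so that the induction is uniform.
\<close>

lemma carry_digits:
  assumes \<alpha>: "\<And>i. 2 \<le> \<alpha> i"
  shows "(if i = 0 then 1 else 0) + carry \<alpha> (digits \<alpha> n) (\<lambda>i. if i = 0 then 1 else 0) i =
    (if radix \<alpha> i dvd Suc n then 1 else 0)"
proof (induction i)
  case (Suc i)
  let ?c = "if radix \<alpha> i dvd Suc n then 1 else 0 :: nat"
  have pos: "0 < radix \<alpha> i" using \<alpha> by (rule radix_pos)
  have lt: "digits \<alpha> n i < \<alpha> i" using \<alpha>[of i] by (simp add: digits_def)
  have "\<alpha> i \<le> digits \<alpha> n i + ?c \<longleftrightarrow> radix \<alpha> (Suc i) dvd Suc n"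
  proof (cases "radix \<alpha> i dvd Suc n")
    case True
    then have q: "Suc n div radix \<alpha> i = Suc (n div radix \<alpha> i)"
      by (simp add: div_Suc dvd_eq_mod_eq_0)
    have "radix \<alpha> (Suc i) dvd Suc n \<longleftrightarrow> \<alpha> i dvd Suc (n div radix \<alpha> i)"
      using True pos q by (metis dvd_div_iff_mult mult.commute neq0_conv radix_Suc)
    also have "\<dots> \<longleftrightarrow> \<alpha> i \<le> digits \<alpha> n i + 1"
      using lt by (auto simp: digits_def dvd_eq_mod_eq_0 mod_Suc)
    finally show ?thesis using True by simp
  next
    case False
    then have "\<not> radix \<alpha> (Suc i) dvd Suc n"
      by (meson dvd_trans radix_dvd le_Suc_eq order_refl)
    with False lt show ?thesis by simp
  qed
  then have "\<not> digits \<alpha> n i + ?c < \<alpha> i \<longleftrightarrow> radix \<alpha> (Suc i) dvd Suc n" by linarith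
  moreover have "digits \<alpha> n i + (if i = 0 then 1 else 0) +
      carry \<alpha> (digits \<alpha> n) (\<lambda>i. if i = 0 then 1 else 0) i = digits \<alpha> n i + ?c"
    using Suc.IH by linarith
  moreover have "carry \<alpha> (digits \<alpha> n) (\<lambda>i. if i = 0 then 1 else 0) (Suc i) =
      (if digits \<alpha> n i + (if i = 0 then 1 else 0) +
        carry \<alpha> (digits \<alpha> n) (\<lambda>i. if i = 0 then 1 else 0) i < \<alpha> i then 0 else 1)"
    by (rule carry.simps)
  ultimately have "carry \<alpha> (digits \<alpha> n) (\<lambda>i. if i = 0 then 1 else 0) (Suc i) =
      (if radix \<alpha> (Suc i) dvd Suc n then 1 else 0)"
    by presburger
  then show ?case by (simp del: radix_Suc carry.simps)
qed simp

lemma digits_Suc: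
  assumes \<alpha>: "\<And>i. 2 \<le> \<alpha> i"
  shows "digits \<alpha> (Suc n) = odometer \<alpha> (digits \<alpha> n)"
proof
  fix i
  have "odometer \<alpha> (digits \<alpha> n) i = (digits \<alpha> n i + (if radix \<alpha> i dvd Suc n then 1 else 0)) mod \<alpha> i"
    using carry_digits[of \<alpha> i n, OF \<alpha>] by (simp add: odometer_def odometer_add_def add.assoc)
  also have "\<dots> = digits \<alpha> (Suc n) i"
    by (auto simp: digits_def div_Suc dvd_eq_mod_eq_0 mod_Suc_eq)
  finally show "digits \<alpha> (Suc n) i = odometer \<alpha> (digits \<alpha> n) i" by simp
qed

lemma odometer_agree:
  assumes "agree L x y"
  shows "agree L (odometer \<alpha> x) (odometer \<alpha> y)"
proof -
  have "carry \<alpha> x e i = carry \<alpha> y e i" if "i < L" for e i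
    using that assms by (induction i) (auto simp: agree_def)
  then show ?thesis using assms by (simp add: agree_def odometer_def odometer_add_def)
qed

text \<open>Density of the natural numbers in the odometer space: every finite digit string occurs.\<close>

lemma digits_surj:
  assumes \<alpha>: "\<And>i. 2 \<le> \<alpha> i" and x: "\<And>i. x i < \<alpha> i"
  shows "\<exists>n<radix \<alpha> k. agree k (digits \<alpha> n) x"
proof (induction k)
  case (Suc k)
  then obtain n where n: "n < radix \<alpha> k" "agree k (digits \<alpha> n) x" by blast
  let ?m = "n + radix \<alpha> k * x k"
  have "agree k (digits \<alpha> ?m) (digits \<alpha> n)" by (simp add: agree_digits_iff)
  then have "agree k (digits \<alpha> ?m) x" using n(2) by (rule agree_trans)
  moreover have "digits \<alpha> ?m k = x k" using n(1) x[of k] by (simp add: digits_def)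
  ultimately have "agree (Suc k) (digits \<alpha> ?m) x" by (auto simp: agree_def less_Suc_eq)
  moreover have "?m < radix \<alpha> (Suc k)"
  proof -
    have "?m < radix \<alpha> k * Suc (x k)" using n(1) by simp
    also have "\<dots> \<le> radix \<alpha> k * \<alpha> k" using x[of k] by (intro mult_le_mono2) simp
    finally show ?thesis by simp
  qed
  ultimately show ?case by blast
qed (simp add: agree_def)

lemma cluster_points_digits:
  assumes \<alpha>: "\<And>i. 2 \<le> \<alpha> i"
  shows "cluster_points (digits \<alpha>) = {x. \<forall>i. x i < \<alpha> i}"
proof (intro equalityI subsetI)
  fix x assume x: "x \<in> cluster_points (digits \<alpha>)"
  have "x i < \<alpha> i" for i
  proof -
    obtain n where "agree (Suc i) (digits \<alpha> n) x" using x unfolding cluster_points_def by blast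
    then have "x i = digits \<alpha> n i" by (simp add: agree_def)
    also have "\<dots> < \<alpha> i" using \<alpha>[of i] by (simp add: digits_def)
    finally show ?thesis .
  qed
  then show "x \<in> {x. \<forall>i. x i < \<alpha> i}" by simp
next
  fix x assume "x \<in> {x. \<forall>i. x i < \<alpha> i}"
  then have x: "\<And>i. x i < \<alpha> i" by simp
  have "\<exists>n\<ge>L. agree L (digits \<alpha> n) x" for L
  proof -
    obtain n where n: "agree L (digits \<alpha> n) x" using digits_surj[of \<alpha> x L, OF \<alpha> x] by blast
    \<comment> \<open>Adding a multiple of \<open>radix \<alpha> L\<close> keeps the first \<open>L\<close> digits and makes the time large.\<close>
    let ?m = "n + radix \<alpha> L * L"
    have "agree L (digits \<alpha> ?m) (digits \<alpha> n)" by (simp add: agree_digits_iff)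
    then have "agree L (digits \<alpha> ?m) x" using n by (rule agree_trans)
    moreover have "1 * L \<le> radix \<alpha> L * L"
      using radix_pos[of \<alpha> L, OF \<alpha>] by (intro mult_le_mono1) simp
    then have "L \<le> ?m" by linarith
    ultimately show ?thesis by blast
  qed
  then show "x \<in> cluster_points (digits \<alpha>)" unfolding cluster_points_def by blast
qed

lemma odometer_space_eq: "odometer_space \<alpha> = top_of_set {x. \<forall>i. x i < \<alpha> i}"
proof -
  have "discrete_topology (UNIV :: nat set) = euclidean"
    by (simp add: discrete_topology_unique open_discrete)
  then have "discrete_topology {..<\<alpha> i} = top_of_set {..<\<alpha> i}" for i
    by (metis subtopology_discrete_topology Int_UNIV_left)
  then have "odometer_space \<alpha> = subtopology (product_topology (\<lambda>_. euclidean) UNIV) (Pi\<^sub>E UNIV (\<lambda>i. {..<\<alpha> i}))"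
    unfolding odometer_space_def subtopology_product_topology by simp
  moreover have "Pi\<^sub>E UNIV (\<lambda>i. {..<\<alpha> i}) = {x. \<forall>i. x i < \<alpha> i}" by auto
  ultimately show ?thesis by (simp add: euclidean_product_topology)
qed

text \<open>
  Universality enters here: each prime has unbounded multiplicity in the partial products, and only
  finitely many primes divide \<open>q\<close>.
\<close>

lemma dvd_radix:
  assumes \<alpha>: "universal_odometer_seq \<alpha>" and q: "0 < q"
  shows "\<exists>k. q dvd radix \<alpha> k"
proof -
  have \<alpha>2: "2 \<le> \<alpha> i" for i using \<alpha> by (simp add: universal_odometer_seq_def)
  have mult_radix: "multiplicity p (radix \<alpha> k) = (\<Sum>i<k. multiplicity p (\<alpha> i))" if "prime p" for p k
    unfolding radix_def
  proof (rule prime_elem_multiplicity_prod_distrib)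
    show "prime_elem p" using that by (rule prime_imp_prime_elem)
    have "\<alpha> i \<noteq> 0" for i using \<alpha>2[of i] by simp
    then show "0 \<notin> \<alpha> ` {..<k}" by (metis imageE)
  qed simp
  have "\<exists>k. multiplicity p q \<le> multiplicity p (radix \<alpha> k)" if p: "prime p" for p
  proof -
    have "odometer_mult \<alpha> p = \<infinity>" using \<alpha> p by (simp add: universal_odometer_seq_def)
    then have "enat (multiplicity p q) < (SUP n. \<Sum>i<n. enat (multiplicity p (\<alpha> i)))"
      by (simp add: odometer_mult_eq_SUP)
    then obtain k where "enat (multiplicity p q) < (\<Sum>i<k. enat (multiplicity p (\<alpha> i)))"
      by (auto simp: less_SUP_iff)
    also have "\<dots> = enat (multiplicity p (radix \<alpha> k))"
      by (simp add: mult_radix[OF p] of_nat_eq_enat[symmetric] of_nat_sum)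
    finally show ?thesis by (auto intro: less_imp_le)
  qed
  then obtain k where k: "\<And>p. prime p \<Longrightarrow> multiplicity p q \<le> multiplicity p (radix \<alpha> (k p))" by metis
  define K where "K = (\<Sum>p\<in>prime_factors q. k p)"
  have "q dvd radix \<alpha> K"
  proof (rule multiplicity_le_imp_dvd)
    show "q \<noteq> 0" using q by simp
    fix p :: nat assume p: "prime p"
    show "multiplicity p q \<le> multiplicity p (radix \<alpha> K)"
    proof (cases "p \<in> prime_factors q")
      case True
      then have "k p \<le> K" unfolding K_def by (intro member_le_sum) auto
      then have "multiplicity p (radix \<alpha> (k p)) \<le> multiplicity p (radix \<alpha> K)"
        using radix_pos[of \<alpha> K, OF \<alpha>2] by (intro dvd_imp_multiplicity_le radix_dvd) auto
      with k[OF p] show ?thesis by simp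
    next
      case False
      then have "multiplicity p q = 0"
        using p q by (simp add: in_prime_factors_iff not_dvd_imp_multiplicity_0)
      then show ?thesis by simp
    qed
  qed
  then show ?thesis by blast
qed

section \<open>Maps with clocks on finite prefixes\<close>

text \<open>
  The map \<open>f\<close> induces a map on words of length \<open>l\<close>, and \<open>c\<close> modulo \<open>N\<close> is a semiconjugacy from it
  to the rotation of the integers modulo \<open>N\<close>. Thus all cycles of the induced map have length divisible
  by \<open>N\<close>.
\<close>

definition clock :: "nat \<Rightarrow> nat \<Rightarrow> (cantor \<Rightarrow> cantor) \<Rightarrow> (cantor \<Rightarrow> nat) \<Rightarrow> bool" where
  "clock N l f c \<longleftrightarrow>
     (\<forall>\<sigma> \<tau>. agree l \<sigma> \<tau> \<longrightarrow> agree l (f \<sigma>) (f \<tau>) \<and> c \<sigma> = c \<tau>) \<and>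
     (\<forall>\<sigma>. c (f \<sigma>) = Suc (c \<sigma>) mod N)"

text \<open>
  The period \<open>fact m\<close> ensures that every positive integer divides the period of some clock; the bound
  \<open>m \<le> l\<close> makes clocks available at arbitrarily high levels.
\<close>

definition clock_maps :: "nat \<Rightarrow> (cantor \<Rightarrow> cantor) set" where
  "clock_maps m = {f. continuous_on UNIV f \<and> (\<exists>l\<ge>m. \<exists>c. clock (fact m) l f c)}"

lemma clock_agree:
  assumes "clock N l f c"
  shows "agree l \<sigma> \<tau> \<Longrightarrow> agree l (f \<sigma>) (f \<tau>)"
  using assms unfolding clock_def by blast

lemma clock_funpow:
  assumes c: "clock N l f c"
  shows "c ((f ^^ n) \<sigma>) mod N = (c \<sigma> + n) mod N"
proof (induction n)
  case (Suc n)
  have "c ((f ^^ Suc n) \<sigma>) mod N = Suc (c ((f ^^ n) \<sigma>)) mod N"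
    using c unfolding clock_def by simp
  also have "\<dots> = Suc (c ((f ^^ n) \<sigma>) mod N) mod N" by (simp add: mod_Suc_eq)
  also have "\<dots> = (c \<sigma> + Suc n) mod N" by (simp add: Suc.IH mod_Suc_eq)
  finally show ?case .
qed simp

lemma clock_detects_time:
  assumes c: "clock N l f c" and ag: "agree l ((f ^^ m) \<sigma>) ((f ^^ n) \<sigma>)"
  shows "m mod N = n mod N"
proof -
  have "c ((f ^^ m) \<sigma>) = c ((f ^^ n) \<sigma>)" using c ag unfolding clock_def by blast
  then have "(c \<sigma> + m) mod N = (c \<sigma> + n) mod N"
    using clock_funpow[OF c] by metis
  then have "int (c \<sigma> + m) mod int N = int (c \<sigma> + n) mod int N"
    unfolding zmod_int[symmetric] by simp
  then have "int N dvd int m - int n" by (simp add: mod_eq_dvd_iff)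
  then have "int m mod int N = int n mod int N" by (simp add: mod_eq_dvd_iff)
  then show ?thesis by (simp add: zmod_int[symmetric])
qed

text \<open>
  There are only finitely many words of length \<open>l\<close>, so by the pigeonhole principle some prefix recurs,
  and from then on the prefixes repeat.
\<close>

lemma eventually_periodic_prefix:
  fixes f :: "cantor \<Rightarrow> cantor"
  assumes f: "\<And>\<sigma> \<tau>. agree l \<sigma> \<tau> \<Longrightarrow> agree l (f \<sigma>) (f \<tau>)"
  shows "\<exists>q>0. \<exists>N. \<forall>m\<ge>N. \<forall>n\<ge>N. m mod q = n mod q \<longrightarrow> agree l ((f ^^ m) \<sigma>) ((f ^^ n) \<sigma>)"
proof -
  define w where "w n = {i. i < l \<and> (f ^^ n) \<sigma> i}" for n
  have w: "agree l ((f ^^ m) \<sigma>) ((f ^^ n) \<sigma>)" if "w m = w n" for m n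
    using that unfolding w_def agree_def by blast
  have "range w \<subseteq> Pow {..<l}" by (auto simp: w_def)
  then have "finite (range w)" by (rule finite_subset) simp
  then have "\<not> inj w" using finite_imageD by blast
  then obtain i j where ij: "i < j" "w i = w j"
    unfolding inj_def by (metis nat_neq_iff)
  define q where "q = j - i"
  have shift: "agree l ((f ^^ (i + k)) \<sigma>) ((f ^^ (i + k + q)) \<sigma>)" for k
  proof (induction k)
    case 0
    then show ?case using w[OF ij(2)] ij(1) by (simp add: q_def)
  next
    case (Suc k)
    then show ?case using f by simp
  qed
  have multi: "agree l ((f ^^ m) \<sigma>) ((f ^^ (m + t * q)) \<sigma>)" if "i \<le> m" for m t
  proof (induction t)
    case (Suc t)
    have "agree l ((f ^^ (m + t * q)) \<sigma>) ((f ^^ (m + t * q + q)) \<sigma>)"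
      using shift[of "m + t * q - i"] that by simp
    with Suc.IH show ?case by (metis agree_trans add.assoc add.commute mult_Suc)
  qed simp
  have one_way: "agree l ((f ^^ m) \<sigma>) ((f ^^ n) \<sigma>)" if "i \<le> m" and mn: "m \<le> n" and "m mod q = n mod q" for m n
  proof -
    have "q dvd n - m" using that by (metis mod_eq_dvd_iff_nat)
    then obtain t where "n = m + t * q"
      using mn by (metis dvdE le_add_diff_inverse mult.commute)
    with multi[OF \<open>i \<le> m\<close>] show ?thesis by simp
  qed
  have "agree l ((f ^^ m) \<sigma>) ((f ^^ n) \<sigma>)" if "i \<le> m" "i \<le> n" "m mod q = n mod q" for m n
    using one_way[of m n] one_way[of n m] that by (metis agree_sym nat_le_linear)
  moreover have "0 < q" using ij(1) by (simp add: q_def)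
  ultimately show ?thesis by blast
qed

text \<open>
  A clock whose period is a multiple of \<open>radix \<alpha> L\<close> lets prefixes of the orbit determine \<open>L\<close> digits of
  the time. Conversely, the eventual period \<open>q\<close> of the prefixes divides some \<open>radix \<alpha> k\<close>, so that \<open>k\<close>
  digits of the time determine the prefix.
\<close>

theorem conjugate_to_universal_odometer:
  assumes f: "\<And>m. f \<in> clock_maps m" and \<alpha>: "universal_odometer_seq \<alpha>"
  shows "topologically_conjugate
    (top_of_set (omega_limit \<sigma> f)) (restrict f (omega_limit \<sigma> f)) (odometer_space \<alpha>) (odometer \<alpha>)"
proof -
  have \<alpha>2: "2 \<le> \<alpha> i" for i using \<alpha> by (simp add: universal_odometer_seq_def)
  have level: "\<exists>l\<ge>m. \<exists>c. clock (fact m) l f c" for m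
    using f unfolding clock_maps_def by blast
  let ?a = "\<lambda>n. (f ^^ n) \<sigma>"
  have "determines ?a (digits \<alpha>)"
    unfolding determines_def
  proof
    fix L
    obtain l c where c: "clock (fact (radix \<alpha> L)) l f c" using level by blast
    have dvd: "radix \<alpha> L dvd fact (radix \<alpha> L)"
      using radix_pos[of \<alpha> L, OF \<alpha>2] by (intro dvd_fact) auto
    have "agree L (digits \<alpha> m) (digits \<alpha> n)" if "agree l (?a m) (?a n)" for m n
      unfolding agree_digits_iff
      using clock_detects_time[OF c that] mod_mod_cancel[OF dvd] by metis
    then show "\<exists>K N. \<forall>m\<ge>N. \<forall>n\<ge>N. agree K (?a m) (?a n) \<longrightarrow> agree L (digits \<alpha> m) (digits \<alpha> n)"
      by blast
  qed
  moreover have "determines (digits \<alpha>) ?a"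
    unfolding determines_def
  proof
    fix L
    obtain l c where l: "L \<le> l" and c: "clock (fact L) l f c" using level by blast
    obtain q N where q: "0 < q" and
      N: "\<And>m n. N \<le> m \<Longrightarrow> N \<le> n \<Longrightarrow> m mod q = n mod q \<Longrightarrow> agree l (?a m) (?a n)"
      using eventually_periodic_prefix[of l f \<sigma>, OF clock_agree[OF c]] by blast
    obtain k where k: "q dvd radix \<alpha> k" using dvd_radix[OF \<alpha> q] by blast
    have "agree L (?a m) (?a n)" if "N \<le> m" "N \<le> n" "agree k (digits \<alpha> m) (digits \<alpha> n)" for m n
    proof -
      have "m mod q = n mod q"
        using that(3) mod_mod_cancel[OF k] unfolding agree_digits_iff by metis
      with that(1,2) have "agree l (?a m) (?a n)" by (rule N)
      then show ?thesis using l by (rule agree_mono)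
    qed
    then show "\<exists>K N. \<forall>m\<ge>N. \<forall>n\<ge>N. agree K (digits \<alpha> m) (digits \<alpha> n) \<longrightarrow> agree L (?a m) (?a n)"
      by blast
  qed
  moreover have "\<exists>K. \<forall>y z. agree K y z \<longrightarrow> agree L (f y) (f z)" for L
    using f[of 0] unfolding clock_maps_def by (blast intro: uniformly_continuous_agree)
  moreover have "\<exists>K. \<forall>y z. agree K y z \<longrightarrow> agree L (odometer \<alpha> y) (odometer \<alpha> z)" for L
    using odometer_agree by blast
  ultimately have "topologically_conjugate (top_of_set (cluster_points ?a)) (restrict f (cluster_points ?a))
      (top_of_set (cluster_points (digits \<alpha>))) (odometer \<alpha>)"
    using digits_Suc[of \<alpha>, OF \<alpha>2] by (intro conjugate_on_cluster_points) simp_all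
  then show ?thesis
    by (simp add: omega_limit_eq_cluster_points odometer_space_eq cluster_points_digits[of \<alpha>, OF \<alpha>2])
qed

section \<open>Maps with clocks are generic\<close>

text \<open>
  The maximum in the metric is attained, so a strict bound on the distance is a bound at every point.
\<close>

lemma mdist_cantor_maps_less_iff:
  assumes "continuous_on UNIV f" "continuous_on UNIV g"
  shows "mdist cantor_maps f g < 1 / real (Suc n) \<longleftrightarrow> (\<forall>\<sigma>. agree (Suc n) (f \<sigma>) (g \<sigma>))"
proof -
  have agree: "cantor_dist \<sigma> \<tau> < 1 / real (Suc n) \<longleftrightarrow> agree (Suc n) \<sigma> \<tau>" for \<sigma> \<tau>
    unfolding cantor_dist_less_iff agree_def by (simp add: less_Suc_eq_le)
  have "cantor_dist (f \<sigma>) (g \<sigma>) \<le> mdist cantor_maps f g" for \<sigma>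
    unfolding mdist_cantor_maps[OF assms]
    by (rule cSUP_upper) (auto intro!: bdd_aboveI[of _ 1] simp: cantor_dist_le_1)
  then show ?thesis
    unfolding agree[symmetric] using mdist_cantor_maps_attained[OF assms]
    by (metis le_less_trans)
qed

lemma openin_clock_maps: "openin (mtopology_of cantor_maps) (clock_maps m)"
proof -
  interpret Metric_space "mspace cantor_maps" "mdist cantor_maps" by (rule Metric_space_mspace_mdist)
  have "\<exists>r>0. mball f r \<subseteq> clock_maps m" if f: "f \<in> clock_maps m" for f
  proof -
    obtain l c where l: "m \<le> l" and c: "clock (fact m) l f c" and cont: "continuous_on UNIV f"
      using f unfolding clock_maps_def by blast
    have "g \<in> clock_maps m" if g: "g \<in> mball f (1 / real (Suc l))" for g
    proof -
      have "g \<in> mspace cantor_maps" using g unfolding in_mball by blast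
      then have cont': "continuous_on UNIV g" by (simp add: mspace_cantor_maps)
      have fg: "agree l (f \<sigma>) (g \<sigma>)" for \<sigma>
        using g mdist_cantor_maps_less_iff[OF cont cont', of l]
        by (auto simp del: of_nat_Suc intro: agree_mono[of "Suc l"])
      have "clock (fact m) l g c"
        using c fg unfolding clock_def by (metis agree_sym agree_trans)
      with l cont' show ?thesis unfolding clock_maps_def by blast
    qed
    then show ?thesis by (intro exI[of _ "1 / real (Suc l)"]) auto
  qed
  moreover have "clock_maps m \<subseteq> mspace cantor_maps"
    unfolding clock_maps_def mspace_cantor_maps by blast
  ultimately show ?thesis
    unfolding mtopology_of_def openin_mtopology by blast
qed

text \<open>
  The output of \<open>g\<close> consists of the first \<open>m\<close> entries of \<open>f \<sigma>\<close>, which depend only on the first \<open>l0\<close>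
  entries of \<open>\<sigma>\<close>; then of padding up to position \<open>l\<close>; and of a block of \<open>N\<close> entries in which a
  single \<open>True\<close> marks the next time. All entries from \<open>l + N\<close> on are \<open>False\<close>, so \<open>g \<sigma>\<close> is a
  function of the first \<open>l + N\<close> entries of \<open>\<sigma>\<close>.
\<close>

lemma clock_map_approximates:
  fixes f :: "cantor \<Rightarrow> cantor"
  assumes f: "continuous_on UNIV f" and N: "0 < N"
  shows "\<exists>g l c. continuous_on UNIV g \<and> m \<le> l \<and> clock N l g c \<and> (\<forall>\<sigma>. agree m (f \<sigma>) (g \<sigma>))"
proof -
  obtain l0 where l0: "\<And>\<sigma> \<tau>. agree l0 \<sigma> \<tau> \<Longrightarrow> agree m (f \<sigma>) (f \<tau>)"
    using uniformly_continuous_agree[OF f, of m] by blast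
  define l where "l = max l0 m"
  have l: "l0 \<le> l" "m \<le> l" by (auto simp: l_def)
  \<comment> \<open>The time read from an arbitrary input is the position of the first mark in the block, and \<open>N\<close> if
    there is none; after one application of \<open>g\<close> it is less than \<open>N\<close>.\<close>
  define c where "c \<sigma> = (LEAST j. j = N \<or> \<sigma> (l + j))" for \<sigma> :: cantor
  define g where "g \<sigma> = (\<lambda>k. if k < m then f \<sigma> k else k = l + Suc (c \<sigma>) mod N)" for \<sigma>
  have c_cong: "c \<sigma> = c \<tau>" if "agree (l + N) \<sigma> \<tau>" for \<sigma> \<tau>
  proof -
    have le: "c \<tau> \<le> c \<sigma>" if ag: "agree (l + N) \<sigma> \<tau>" for \<sigma> \<tau>
    proof -
      have "c \<sigma> = N \<or> \<sigma> (l + c \<sigma>)" unfolding c_def by (rule LeastI[of _ N]) simp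
      moreover have "c \<sigma> \<le> N" unfolding c_def by (rule Least_le) simp
      ultimately have "c \<sigma> = N \<or> \<tau> (l + c \<sigma>)" using ag by (auto simp: agree_def le_less)
      then show ?thesis unfolding c_def[of \<tau>] by (rule Least_le)
    qed
    from le[OF that] le[OF agree_sym[OF that]] show ?thesis by simp
  qed
  have c_g: "c (g \<sigma>) = Suc (c \<sigma>) mod N" for \<sigma>
    unfolding c_def[of "g \<sigma>"]
    using N l(2) mod_less_divisor[OF N, of "Suc (c \<sigma>)"]
    by (intro Least_equality) (auto simp: g_def)
  have g_cong: "g \<sigma> k = g \<tau> k" if "agree (l + N) \<sigma> \<tau>" for \<sigma> \<tau> k
    using l0[OF agree_mono[OF that]] l(1) c_cong[OF that] by (simp add: g_def agree_def)
  have "clock N (l + N) g c"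
    unfolding clock_def using g_cong c_cong c_g by (simp add: agree_def)
  moreover have "continuous_on UNIV g"
  proof (rule continuous_on_if_agree)
    show "\<exists>K. \<forall>y\<in>UNIV. \<forall>z\<in>UNIV. agree K y z \<longrightarrow> agree L (g y) (g z)" for L
      using g_cong unfolding agree_def[of L] by blast
  qed
  moreover have "agree m (f \<sigma>) (g \<sigma>)" for \<sigma> by (simp add: agree_def g_def)
  ultimately show ?thesis using l(2) by (meson trans_le_add1)
qed

lemma clock_maps_dense:
  "mtopology_of cantor_maps closure_of clock_maps m = topspace (mtopology_of cantor_maps)"
proof -
  interpret Metric_space "mspace cantor_maps" "mdist cantor_maps" by (rule Metric_space_mspace_mdist)
  have "f \<in> mtopology closure_of clock_maps m" if f: "f \<in> mspace cantor_maps" for f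
    unfolding metric_closure_of
  proof (clarsimp simp: f)
    fix r :: real assume "0 < r"
    then obtain n where n: "1 / real (Suc n) < r" using nat_approx_posE by blast
    have cont: "continuous_on UNIV f" using f by (simp add: mspace_cantor_maps)
    obtain g l c where g: "continuous_on UNIV g" "max m (Suc n) \<le> l" "clock (fact m) l g c"
      "\<And>\<sigma>. agree (max m (Suc n)) (f \<sigma>) (g \<sigma>)"
      using clock_map_approximates[OF cont, of "fact m" "max m (Suc n)"] by auto
    have "g \<in> clock_maps m" using g(1-3) unfolding clock_maps_def by auto
    moreover have "mdist cantor_maps f g < 1 / real (Suc n)"
      unfolding mdist_cantor_maps_less_iff[OF cont g(1)]
      using agree_mono[OF g(4)] by simp
    ultimately show "\<exists>g\<in>clock_maps m. g \<in> mspace cantor_maps \<and> mdist cantor_maps f g < r"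
      using g(1) n by (intro bexI[of _ g]) (auto simp: mspace_cantor_maps)
  qed
  then have "mspace cantor_maps \<subseteq> mtopology closure_of clock_maps m" by blast
  then show ?thesis
    unfolding mtopology_of_def topspace_mtopology
    by (metis closure_of_subset_topspace subset_antisym topspace_mtopology)
qed

lemma comeager_in_Inter_dense_open:
  assumes "\<And>m::nat. openin X (U m)" "\<And>m. X closure_of U m = topspace X"
  shows "comeager_in X (\<Inter>m. U m)"
proof -
  have "nowhere_dense_in X (topspace X - U m)" for m
    unfolding nowhere_dense_in_def
    using assms(1)[of m] assms(2)[of m]
    by (simp add: closure_of_closedin closedin_diff interior_of_complement)
  moreover have "topspace X - (\<Inter>m. U m) = \<Union>(range (\<lambda>m. topspace X - U m))" by blast
  ultimately have "meager_in X (topspace X - (\<Inter>m. U m))"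
    unfolding meager_in_def
    by (intro exI[of _ "range (\<lambda>m. topspace X - U m)"]) auto
  moreover have "(\<Inter>m. U m) \<subseteq> topspace X" using assms(1) openin_subset by blast
  ultimately show ?thesis unfolding comeager_in_def by blast
qed

theorem theorem5p4:
  shows "\<exists>A. comeager_in (mtopology_of cantor_maps) A \<and>
    (\<forall>f\<in>A. \<forall>\<sigma>::cantor. \<forall>\<alpha>. universal_odometer_seq \<alpha> \<longrightarrow>
       topologically_conjugate
         (top_of_set (omega_limit \<sigma> f)) (restrict f (omega_limit \<sigma> f))
         (odometer_space \<alpha>) (odometer \<alpha>))"
proof (intro exI conjI ballI allI impI)
  show "comeager_in (mtopology_of cantor_maps) (\<Inter>m. clock_maps m)"
    by (rule comeager_in_Inter_dense_open[OF openin_clock_maps clock_maps_dense])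
next
  fix f \<sigma> \<alpha> assume "f \<in> (\<Inter>m. clock_maps m)" "universal_odometer_seq \<alpha>"
  then show "topologically_conjugate
      (top_of_set (omega_limit \<sigma> f)) (restrict f (omega_limit \<sigma> f)) (odometer_space \<alpha>) (odometer \<alpha>)"
    by (intro conjugate_to_universal_odometer) auto
qed

end
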